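(* Consider the extreme shock model with possibly increasing threshold described in the context, with $\alpha_{k,l}=\alpha+b_k-c_l$. Let $m,j,k,l$ be integers with $j\ge1$, $l\ge 1$ and $0\le k<j$. (i) If $m\ge j+l-1$, then $$P\{\nu>m,\,N_+(m)=k,\,N_-(m+1)=l,\,W=j\}=\binom{j-1}{k}F^{j-1-k}(\gamma)\,[\bar F(\gamma)-\bar F(\beta)]^k\binom{m-j}{l-1}F^{m-j-l+1}(\beta)\prod_{h=1}^{l}[\bar F(\beta)-\bar F(\alpha_{k,h-1})].$$ (ii) If $m\ge j+l$, then $$P\{\nu=m,\,N_+(m)=k,\,N_-(m)=l,\,W=j\}=\binom{j-1}{k}F^{j-1-k}(\gamma)\,[\bar F(\gamma)-\bar F(\beta)]^k\binom{m-j-1}{l-1}F^{m-j-l}(\beta)\prod_{h=1}^{l}[\bar F(\beta)-\bar F(\alpha_{k,h-1})]\;\bar F(\alpha_{k,l}).$$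
   Context: Let $X_1,X_2,\dots$ be i.i.d. real random variables (shock magnitudes), with $F(x)=P\{X_1<x\}$ and $\bar F(x)=1-F(x)=P\{X_1\ge x\}$; $F^n(x)$ means $(F(x))^n$, and $0^0=1$. Let $\gamma\le\beta\le\alpha$ be real numbers, and let $(b_k)_{k\ge0}$, $(c_l)_{l\ge0}$ be real sequences, $b_0=c_0=0$, $b_1>0$, both nondecreasing, such that $\alpha_{k,l}:=\alpha+b_k-c_l\ge\beta$ for all $k,l\ge0$. Define recursively $N_-(0)=N_+(0)=0$ and, for $n\ge1$, the number of weakening shocks before the $n$-th shock $$N_-(n)=\sum_{1\le i<n}1\{X_i\in[\beta,\ \alpha+b_{N_+(i)}-c_{N_-(i)})\},$$ and the number of strengthening shocks before the $n$-th shock (and before the first weakening shock) $$N_+(n)=\sum_{1\le i<n}1\{X_i\in[\gamma,\beta),\ N_-(i)=0\}.$$ The index of the first harmful shock is $W=\inf\{i\ge1:X_i\ge\beta\}$ and the index of the first fatal shock is $\nu=\min\{i\ge1:X_i\ge\alpha+b_{N_+(i)}-c_{N_-(i)}\}$ (with value $\infty$ if the set is empty). *)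

theory Defs
  imports "HOL-Probability.Probability"
begin

text \<open>The distribution function is the left-continuous one, with the strict inequality;
  it is therefore not the library's \<^const>\<open>cdf\<close>.\<close>

definition df :: "'a measure \<Rightarrow> ('a \<Rightarrow> real) \<Rightarrow> real \<Rightarrow> real" where
  "df M Y x = \<P>(\<omega> in M. Y \<omega> < x)"

definition df_bar :: "'a measure \<Rightarrow> ('a \<Rightarrow> real) \<Rightarrow> real \<Rightarrow> real" where
  "df_bar M Y x = 1 - df M Y x"

definition threshold :: "real \<Rightarrow> (nat \<Rightarrow> real) \<Rightarrow> (nat \<Rightarrow> real) \<Rightarrow> nat \<Rightarrow> nat \<Rightarrow> real" where
  "threshold \<alpha> b c k l = \<alpha> + b k - c l"

text \<open>Shocks are numbered from 1; \<^term>\<open>X 0\<close> is never used. At \<open>n = 0\<close> both sums are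
  empty, which gives the initial values 0.\<close>

function N_minus :: "real \<Rightarrow> real \<Rightarrow> real \<Rightarrow> (nat \<Rightarrow> real) \<Rightarrow> (nat \<Rightarrow> real) \<Rightarrow>
    (nat \<Rightarrow> 'a \<Rightarrow> real) \<Rightarrow> nat \<Rightarrow> 'a \<Rightarrow> nat"
  and N_plus :: "real \<Rightarrow> real \<Rightarrow> real \<Rightarrow> (nat \<Rightarrow> real) \<Rightarrow> (nat \<Rightarrow> real) \<Rightarrow>
    (nat \<Rightarrow> 'a \<Rightarrow> real) \<Rightarrow> nat \<Rightarrow> 'a \<Rightarrow> nat"
where
  "N_minus \<alpha> \<beta> \<gamma> b c X n \<omega> =
    (\<Sum>i = 1..<n. of_bool (X i \<omega> \<in>
      {\<beta> ..< threshold \<alpha> b c (N_plus \<alpha> \<beta> \<gamma> b c X i \<omega>) (N_minus \<alpha> \<beta> \<gamma> b c X i \<omega>)}))"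
| "N_plus \<alpha> \<beta> \<gamma> b c X n \<omega> =
    (\<Sum>i = 1..<n. of_bool (X i \<omega> \<in> {\<gamma> ..< \<beta>} \<and> N_minus \<alpha> \<beta> \<gamma> b c X i \<omega> = 0))"
  by pat_completeness auto
termination
  by (relation "Wellfounded.measure (case_sum (\<lambda>(_, _, _, _, _, _, n, _). n) (\<lambda>(_, _, _, _, _, _, n, _). n))")
    auto

text \<open>The equations are unconditional and would loop as rewrite rules.\<close>
declare N_minus.simps [simp del] N_plus.simps [simp del]

text \<open>In \<^typ>\<open>enat\<close> the infimum of the empty set is \<open>\<infinity>\<close>.\<close>

definition first_harmful :: "real \<Rightarrow> (nat \<Rightarrow> 'a \<Rightarrow> real) \<Rightarrow> 'a \<Rightarrow> enat" where
  "first_harmful \<beta> X \<omega> = Inf {enat i | i. i \<ge> 1 \<and> X i \<omega> \<ge> \<beta>}"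

definition first_fatal :: "real \<Rightarrow> real \<Rightarrow> real \<Rightarrow> (nat \<Rightarrow> real) \<Rightarrow> (nat \<Rightarrow> real) \<Rightarrow>
    (nat \<Rightarrow> 'a \<Rightarrow> real) \<Rightarrow> 'a \<Rightarrow> enat" where
  "first_fatal \<alpha> \<beta> \<gamma> b c X \<omega> = Inf {enat i | i. i \<ge> 1 \<and>
    X i \<omega> \<ge> threshold \<alpha> b c (N_plus \<alpha> \<beta> \<gamma> b c X i \<omega>) (N_minus \<alpha> \<beta> \<gamma> b c X i \<omega>)}"

end

theory Submission
  imports Defs
begin

text \<open>While no shock has reached \<open>\<beta>\<close>, each new one is either below \<open>\<gamma>\<close> or raises \<open>N\<^sub>+\<close>. From shock
  \<open>W\<close> on, \<open>N\<^sub>+\<close> is frozen at \<open>k\<close>, and each shock survived is either below \<open>\<beta>\<close> or raises \<open>N\<^sub>-\<close> by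
  hitting \<open>[\<beta>, \<alpha>\<^bsub>k,h\<^esub>)\<close>. Both phases are counters whose next increment is independent of the
  history, so Pascal's rule gives a binomial coefficient times the probability of one path.\<close>

definition history :: "'a measure \<Rightarrow> (nat \<Rightarrow> 'a \<Rightarrow> real) \<Rightarrow> nat \<Rightarrow> 'a set set" where
  "history M X n =
    {(\<lambda>\<omega>. \<lambda>i\<in>{1..n}. X i \<omega>) -` S \<inter> space M | S. S \<in> sets (PiM {1..n} (\<lambda>_. borel))}"

lemma history_eq_sets_vimage_algebra:
  "history M X n =
    sets (vimage_algebra (space M) (\<lambda>\<omega>. \<lambda>i\<in>{1..n}. X i \<omega>) (PiM {1..n} (\<lambda>_. borel)))"
  unfolding history_def by (subst sets_vimage_algebra2) (auto simp: space_PiM)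

lemma space_in_history: "space M \<in> history M X n"
  unfolding history_eq_sets_vimage_algebra by (rule sets_vimage_algebra_space)

lemma empty_in_history: "{} \<in> history M X n"
  unfolding history_eq_sets_vimage_algebra by (rule sets.empty_sets)

lemma Un_in_history: "A \<in> history M X n \<Longrightarrow> B \<in> history M X n \<Longrightarrow> A \<union> B \<in> history M X n"
  unfolding history_eq_sets_vimage_algebra by (rule sets.Un)

lemma history_extend:
  assumes A: "A \<in> history M X n" and U: "U \<in> sets borel"
  shows "A \<inter> {\<omega> \<in> space M. X (Suc n) \<omega> \<in> U} \<in> history M X (Suc n)"
proof -
  let ?P = "PiM {1..Suc n} (\<lambda>_. borel :: real measure)"
  obtain S where S: "S \<in> sets (PiM {1..n} (\<lambda>_. borel :: real measure))"
    and A_eq: "A = (\<lambda>\<omega>. \<lambda>i\<in>{1..n}. X i \<omega>) -` S \<inter> space M"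
    using A by (auto simp: history_def)
  have r: "(\<lambda>x. restrict x {1..n}) \<in> measurable ?P (PiM {1..n} (\<lambda>_. borel))"
    by (rule measurable_restrict_subset) auto
  have p: "(\<lambda>x. x (Suc n)) \<in> measurable ?P borel"
    by (rule measurable_component_singleton) auto
  let ?T = "((\<lambda>x. restrict x {1..n}) -` S \<inter> space ?P) \<inter> ((\<lambda>x. x (Suc n)) -` U \<inter> space ?P)"
  have "?T \<in> sets ?P"
    using measurable_sets[OF r S] measurable_sets[OF p U] by (rule sets.Int)
  moreover have "restrict (\<lambda>i\<in>{1..Suc n}. X i \<omega>) {1..n} = (\<lambda>i\<in>{1..n}. X i \<omega>)" for \<omega>
    by (auto simp: restrict_def fun_eq_iff)
  hence "A \<inter> {\<omega> \<in> space M. X (Suc n) \<omega> \<in> U} = (\<lambda>\<omega>. \<lambda>i\<in>{1..Suc n}. X i \<omega>) -` ?T \<inter> space M"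
    unfolding A_eq by (auto simp: space_PiM)
  ultimately show ?thesis unfolding history_def by blast
qed

lemma vimage_component_singleton:
  "(\<lambda>\<omega>. \<lambda>i\<in>{j}. X i \<omega>) -` ((\<lambda>x. x j) -` U \<inter> space (PiM {j} (\<lambda>_. borel))) \<inter> B =
    {\<omega> \<in> B. X j \<omega> \<in> U}"
proof -
  have "(\<lambda>i\<in>{j}. X i \<omega>) \<in> space (PiM {j} (\<lambda>_. borel))" for \<omega>
    unfolding space_PiM space_borel by (rule restrict_PiE_iff[THEN iffD2]) (rule ballI, rule UNIV_I)
  moreover have "(\<lambda>i\<in>{j}. X i \<omega>) j = X j \<omega>" for \<omega>
    by (rule restrict_apply') (rule singletonI)
  ultimately show ?thesis
    unfolding set_eq_iff Int_iff vimage_eq mem_Collect_eq by auto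
qed

lemma vimage_Pair_Times:
  "(\<lambda>\<omega>. (f \<omega>, g \<omega>)) -` (P \<times> R) \<inter> B = (f -` P \<inter> B) \<inter> (g -` R \<inter> B)"
  by blast

context prob_space
begin

lemma history_subset_events:
  assumes "indep_vars (\<lambda>_. borel) X {1..}"
  shows "history M X n \<subseteq> events"
proof -
  have "(\<lambda>\<omega>. \<lambda>i\<in>{1..n}. X i \<omega>) \<in> measurable M (PiM {1..n} (\<lambda>_. borel))"
    using assms by (intro measurable_restrict) (auto simp: indep_vars_def)
  thus ?thesis by (auto simp: history_def dest: measurable_sets)
qed

lemma prob_history_Int:
  assumes ind: "indep_vars (\<lambda>_. borel) X {1..}"
    and A: "A \<in> history M X n" and U: "U \<in> sets borel"
  shows "prob (A \<inter> {\<omega> \<in> space M. X (Suc n) \<omega> \<in> U}) = prob A * \<P>(\<omega> in M. X (Suc n) \<omega> \<in> U)"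
proof -
  obtain S where S: "S \<in> sets (PiM {1..n} (\<lambda>_. borel :: real measure))"
    and A_eq: "A = (\<lambda>\<omega>. \<lambda>i\<in>{1..n}. X i \<omega>) -` S \<inter> space M"
    using A by (auto simp: history_def)
  let ?Q = "PiM {Suc n} (\<lambda>_. borel :: real measure)"
  let ?T = "(\<lambda>x. x (Suc n)) -` U \<inter> space ?Q"
  have "(\<lambda>x. x (Suc n)) \<in> measurable ?Q borel"
    by (rule measurable_component_singleton) simp
  hence T: "?T \<in> sets ?Q"
    using U by (rule measurable_sets)
  have iv: "indep_var (PiM {1..n} (\<lambda>_. borel)) (\<lambda>\<omega>. \<lambda>i\<in>{1..n}. X i \<omega>) ?Q (\<lambda>\<omega>. \<lambda>i\<in>{Suc n}. X i \<omega>)"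
    by (rule indep_var_restrict[OF ind]) auto
  show ?thesis
    using indep_varD[OF iv S T]
    unfolding vimage_Pair_Times vimage_component_singleton A_eq[symmetric] .
qed

text \<open>\<open>A n h\<close> reads: starting from \<open>A\<^sub>0\<close> at time \<open>s\<close>, the next \<open>n\<close> variables raised a counter
  \<open>h\<close> times. The target set \<open>V h\<close> that raises the counter depends on its current value,
  whereas the set \<open>U\<close> that keeps it does not; so every path has the same probability.\<close>

lemma counter_prob:
  assumes ind: "indep_vars (\<lambda>_. borel) X {1..}"
    and A0: "A\<^sub>0 \<in> history M X s" "A 0 0 = A\<^sub>0" "\<And>h. A 0 (Suc h) = {}"
    and stay: "\<And>n. A (Suc n) 0 = A n 0 \<inter> {\<omega> \<in> space M. X (Suc (s + n)) \<omega> \<in> U}"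
    and step: "\<And>n h. A (Suc n) (Suc h) =
      A n (Suc h) \<inter> {\<omega> \<in> space M. X (Suc (s + n)) \<omega> \<in> U} \<union>
      A n h \<inter> {\<omega> \<in> space M. X (Suc (s + n)) \<omega> \<in> V h}"
    and borel: "U \<in> sets borel" "\<And>h. V h \<in> sets borel" and disj: "\<And>h. U \<inter> V h = {}"
    and u: "\<And>i. i \<ge> 1 \<Longrightarrow> \<P>(\<omega> in M. X i \<omega> \<in> U) = u"
    and v: "\<And>i h. i \<ge> 1 \<Longrightarrow> \<P>(\<omega> in M. X i \<omega> \<in> V h) = v h"
  shows "A n h \<in> history M X (s + n)"
    and "prob (A n h) = prob A\<^sub>0 * real (n choose h) * u ^ (n - h) * (\<Prod>i<h. v i)"
proof -
  have "A n h \<in> history M X (s + n) \<and>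
    prob (A n h) = prob A\<^sub>0 * real (n choose h) * u ^ (n - h) * (\<Prod>i<h. v i)"
  proof (induction n arbitrary: h)
    case 0
    show ?case using A0 by (cases h) (auto simp: empty_in_history)
  next
    case (Suc n)
    note hist = Suc.IH[THEN conjunct1] and pr = Suc.IH[THEN conjunct2]
    have pU: "prob (A n h \<inter> {\<omega> \<in> space M. X (Suc (s + n)) \<omega> \<in> U}) = prob (A n h) * u" for h
      using prob_history_Int[OF ind hist borel(1)] u by simp
    have pV: "prob (A n h \<inter> {\<omega> \<in> space M. X (Suc (s + n)) \<omega> \<in> V h}) = prob (A n h) * v h" for h
      using prob_history_Int[OF ind hist borel(2)] v by simp
    show ?case
    proof (cases h)
      case 0
      thus ?thesis using history_extend[OF hist borel(1), of 0] pU[of 0] pr[of 0] by (simp add: stay)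
    next
      case (Suc h')
      let ?B = "A n (Suc h') \<inter> {\<omega> \<in> space M. X (Suc (s + n)) \<omega> \<in> U}"
      let ?C = "A n h' \<inter> {\<omega> \<in> space M. X (Suc (s + n)) \<omega> \<in> V h'}"
      have H: "?B \<in> history M X (Suc (s + n))" "?C \<in> history M X (Suc (s + n))"
        by (intro history_extend hist borel)+
      have "prob (A (Suc n) (Suc h')) = prob ?B + prob ?C"
        unfolding step using H history_subset_events[OF ind] disj[of h']
        by (intro finite_measure_Union) auto
      also have "\<dots> = prob A\<^sub>0 * (real (n choose Suc h') * (u ^ (n - Suc h') * u)
          + real (n choose h') * u ^ (n - h')) * (\<Prod>i<Suc h'. v i)"
        unfolding pU pV pr by (simp add: algebra_simps)
      also have "real (n choose Suc h') * (u ^ (n - Suc h') * u) = real (n choose Suc h') * u ^ (n - h')"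
      proof (cases "Suc h' \<le> n")
        case True
        hence "n - h' = Suc (n - Suc h')" by simp
        thus ?thesis by simp
      qed simp
      finally have "prob (A (Suc n) (Suc h')) =
          prob A\<^sub>0 * real (Suc n choose Suc h') * u ^ (Suc n - Suc h') * (\<Prod>i<Suc h'. v i)"
        by (simp add: algebra_simps)
      thus ?thesis using H by (simp add: \<open>h = Suc h'\<close> step Un_in_history)
    qed
  qed
  thus "A n h \<in> history M X (s + n)"
    and "prob (A n h) = prob A\<^sub>0 * real (n choose h) * u ^ (n - h) * (\<Prod>i<h. v i)"
    by blast+
qed

end

lemma Inf_enat_Collect_eq_iff:
  "Inf {enat i | i. P i} = enat n \<longleftrightarrow> P n \<and> (\<forall>i<n. \<not> P i)"
proof
  assume *: "Inf {enat i | i. P i} = enat n"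
  hence "{enat i | i. P i} \<noteq> {}" by (auto simp: Inf_enat_def split: if_splits)
  hence "Inf {enat i | i. P i} \<in> {enat i | i. P i}"
    unfolding Inf_enat_def by (auto intro: LeastI)
  hence "P n" using * by auto
  moreover have "n \<le> i" if "P i" for i
    using Inf_lower[of "enat i" "{enat i | i. P i}"] that * by auto
  ultimately show "P n \<and> (\<forall>i<n. \<not> P i)" by force
next
  assume "P n \<and> (\<forall>i<n. \<not> P i)"
  thus "Inf {enat i | i. P i} = enat n"
    by (intro antisym Inf_lower Inf_greatest) (auto simp: not_less[symmetric])
qed

lemma Inf_enat_Collect_gt_iff:
  "enat n < Inf {enat i | i. P i} \<longleftrightarrow> (\<forall>i\<le>n. \<not> P i)"
proof
  assume *: "enat n < Inf {enat i | i. P i}"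
  show "\<forall>i\<le>n. \<not> P i"
  proof (intro allI impI notI)
    fix i assume "i \<le> n" "P i"
    hence "Inf {enat i | i. P i} \<le> enat i" by (intro Inf_lower) auto
    with * \<open>i \<le> n\<close> show False by (meson enat_ord_simps(1) leD order_trans)
  qed
next
  assume *: "\<forall>i\<le>n. \<not> P i"
  have "enat (Suc n) \<le> Inf {enat i | i. P i}"
    by (intro Inf_greatest) (use * in \<open>auto simp: not_less_eq_eq[symmetric]\<close>)
  thus "enat n < Inf {enat i | i. P i}"
    by (meson enat_ord_simps(2) lessI less_le_trans)
qed

lemma ball_Suc_iff: "(\<forall>i\<in>{Suc 0..Suc n}. P i) \<longleftrightarrow> (\<forall>i\<in>{Suc 0..n}. P i) \<and> P (Suc n)"
  by (auto simp: atLeastAtMostSuc_conv)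

lemma lessThan_Int_atLeastLessThan: "{..<x} \<inter> {x..<y} = {}" for x y :: "'a :: linorder"
  by auto

locale shock_thresholds =
  fixes \<alpha> \<beta> \<gamma> :: real and b c :: "nat \<Rightarrow> real" and X :: "nat \<Rightarrow> 'a \<Rightarrow> real"
  assumes threshold_ge: "\<And>k l. threshold \<alpha> b c k l \<ge> \<beta>"
begin

abbreviation "Nm \<equiv> N_minus \<alpha> \<beta> \<gamma> b c X"
abbreviation "Np \<equiv> N_plus \<alpha> \<beta> \<gamma> b c X"
abbreviation "thr \<equiv> threshold \<alpha> b c"

lemma N_1: "Nm (Suc 0) \<omega> = 0" "Np (Suc 0) \<omega> = 0"
  by (simp_all add: N_minus.simps[where n = "Suc 0"] N_plus.simps[where n = "Suc 0"])

lemma Nm_Suc: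
  "n \<ge> 1 \<Longrightarrow> Nm (Suc n) \<omega> = Nm n \<omega> + of_bool (X n \<omega> \<in> {\<beta>..<thr (Np n \<omega>) (Nm n \<omega>)})"
  by (simp add: N_minus.simps[where n = "Suc n"] N_minus.simps[where n = n])

lemma Np_Suc:
  "n \<ge> 1 \<Longrightarrow> Np (Suc n) \<omega> = Np n \<omega> + of_bool (X n \<omega> \<in> {\<gamma>..<\<beta>} \<and> Nm n \<omega> = 0)"
  by (simp add: N_plus.simps[where n = "Suc n"] N_plus.simps[where n = n])

lemma Nm_eq_0:
  "\<forall>i\<in>{1..n}. X i \<omega> < \<beta> \<Longrightarrow> Nm (Suc n) \<omega> = 0"
  by (induction n) (auto simp: N_1 Nm_Suc ball_Suc_iff)

lemma N_after_first_harmful: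
  assumes "j \<ge> 1" "\<forall>i\<in>{1..<j}. X i \<omega> < \<beta>" "\<beta> \<le> X j \<omega>" "X j \<omega> < thr (Np j \<omega>) (Nm j \<omega>)"
  shows "Nm (Suc (j + n)) \<omega> \<ge> 1" "Np (Suc (j + n)) \<omega> = Np j \<omega>"
proof -
  have "Nm (Suc (j + n)) \<omega> \<ge> 1 \<and> Np (Suc (j + n)) \<omega> = Np j \<omega>"
  proof (induction n)
    case 0
    show ?case using assms by (simp add: Nm_Suc Np_Suc)
  next
    case (Suc n)
    thus ?case
      using Nm_Suc[of "Suc (j + n)" \<omega>] Np_Suc[of "Suc (j + n)" \<omega>] by simp
  qed
  thus "Nm (Suc (j + n)) \<omega> \<ge> 1" "Np (Suc (j + n)) \<omega> = Np j \<omega>" by auto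
qed

definition harmless :: "'a measure \<Rightarrow> nat \<Rightarrow> nat \<Rightarrow> 'a set" where
  "harmless M n k = {\<omega> \<in> space M. (\<forall>i\<in>{1..n}. X i \<omega> < \<beta>) \<and> Np (Suc n) \<omega> = k}"

lemma harmless_0: "harmless M 0 0 = space M" "harmless M 0 (Suc k) = {}"
  by (auto simp: harmless_def N_1)

lemma harmless_Suc:
  assumes "\<gamma> \<le> \<beta>"
  shows "harmless M (Suc n) 0 = harmless M n 0 \<inter> {\<omega> \<in> space M. X (Suc n) \<omega> \<in> {..<\<gamma>}}"
    and "harmless M (Suc n) (Suc k) =
      harmless M n (Suc k) \<inter> {\<omega> \<in> space M. X (Suc n) \<omega> \<in> {..<\<gamma>}} \<union>
      harmless M n k \<inter> {\<omega> \<in> space M. X (Suc n) \<omega> \<in> {\<gamma>..<\<beta>}}"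
proof -
  have *: "\<omega> \<in> harmless M (Suc n) k \<longleftrightarrow> \<omega> \<in> space M \<and> (\<forall>i\<in>{1..n}. X i \<omega> < \<beta>) \<and>
      X (Suc n) \<omega> < \<beta> \<and> Np (Suc n) \<omega> + of_bool (X (Suc n) \<omega> \<in> {\<gamma>..<\<beta>}) = k" for \<omega> k
  proof (cases "\<forall>i\<in>{1..n}. X i \<omega> < \<beta>")
    case True
    thus ?thesis using Nm_eq_0[OF True] by (auto simp: harmless_def Np_Suc ball_Suc_iff)
  next
    case False
    thus ?thesis by (auto simp: harmless_def)
  qed
  show "harmless M (Suc n) 0 = harmless M n 0 \<inter> {\<omega> \<in> space M. X (Suc n) \<omega> \<in> {..<\<gamma>}}"
    unfolding set_eq_iff * using assms by (auto simp: harmless_def)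
  show "harmless M (Suc n) (Suc k) =
      harmless M n (Suc k) \<inter> {\<omega> \<in> space M. X (Suc n) \<omega> \<in> {..<\<gamma>}} \<union>
      harmless M n k \<inter> {\<omega> \<in> space M. X (Suc n) \<omega> \<in> {\<gamma>..<\<beta>}}"
    unfolding set_eq_iff * using assms by (auto simp: harmless_def)
qed

text \<open>The counter starts at the first weakening shock, which under survival is the \<open>j\<close>-th
  shock itself: \<open>h\<close> counts the weakening shocks after it.\<close>

definition weakened :: "'a measure \<Rightarrow> nat \<Rightarrow> nat \<Rightarrow> nat \<Rightarrow> nat \<Rightarrow> 'a set" where
  "weakened M j k n h = {\<omega> \<in> space M. (\<forall>i\<in>{1..<j}. X i \<omega> < \<beta>) \<and> \<beta> \<le> X j \<omega> \<and> Np j \<omega> = k \<and>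
    (\<forall>i\<in>{1..j + n}. X i \<omega> < thr (Np i \<omega>) (Nm i \<omega>)) \<and> Nm (Suc (j + n)) \<omega> = Suc h}"

lemma weakened_0:
  "weakened M (Suc j) k 0 0 = harmless M j k \<inter> {\<omega> \<in> space M. X (Suc j) \<omega> \<in> {\<beta>..<thr k 0}}"
  "weakened M (Suc j) k 0 (Suc h) = {}"
proof -
  have "\<omega> \<in> weakened M (Suc j) k 0 h \<longleftrightarrow>
      \<omega> \<in> harmless M j k \<inter> {\<omega> \<in> space M. X (Suc j) \<omega> \<in> {\<beta>..<thr k 0}} \<and> h = 0" for \<omega> h
  proof (cases "\<forall>i\<in>{1..j}. X i \<omega> < \<beta>")
    case True
    have "X i \<omega> < thr (Np i \<omega>) (Nm i \<omega>)" if "i \<in> {1..j}" for i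
      using True that threshold_ge[of "Np i \<omega>" "Nm i \<omega>"] by force
    thus ?thesis using True Nm_eq_0[OF True]
      by (auto simp: weakened_def harmless_def Nm_Suc ball_Suc_iff)
  next
    case False
    thus ?thesis by (auto simp: weakened_def harmless_def)
  qed
  thus "weakened M (Suc j) k 0 0 = harmless M j k \<inter> {\<omega> \<in> space M. X (Suc j) \<omega> \<in> {\<beta>..<thr k 0}}"
    "weakened M (Suc j) k 0 (Suc h) = {}"
    by blast+
qed

lemma weakened_Suc:
  assumes "j \<ge> 1"
  shows "weakened M j k (Suc n) 0 =
      weakened M j k n 0 \<inter> {\<omega> \<in> space M. X (Suc (j + n)) \<omega> \<in> {..<\<beta>}}"
    and "weakened M j k (Suc n) (Suc h) =
      weakened M j k n (Suc h) \<inter> {\<omega> \<in> space M. X (Suc (j + n)) \<omega> \<in> {..<\<beta>}} \<union>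
      weakened M j k n h \<inter> {\<omega> \<in> space M. X (Suc (j + n)) \<omega> \<in> {\<beta>..<thr k (Suc h)}}"
proof -
  define Q where "Q \<omega> \<longleftrightarrow> \<omega> \<in> space M \<and> (\<forall>i\<in>{1..<j}. X i \<omega> < \<beta>) \<and> \<beta> \<le> X j \<omega> \<and> Np j \<omega> = k \<and>
    (\<forall>i\<in>{1..j + n}. X i \<omega> < thr (Np i \<omega>) (Nm i \<omega>))" for \<omega>
  have w: "\<omega> \<in> weakened M j k n h \<longleftrightarrow> Q \<omega> \<and> Nm (Suc (j + n)) \<omega> = Suc h" for \<omega> h
    by (auto simp: weakened_def Q_def)
  have N: "Np (Suc (j + n)) \<omega> = k" "Nm (Suc (j + n)) \<omega> \<noteq> 0" if "Q \<omega>" for \<omega>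
    using N_after_first_harmful[of j \<omega> n] that assms by (auto simp: Q_def)
  have w': "\<omega> \<in> weakened M j k (Suc n) h \<longleftrightarrow> Q \<omega> \<and>
      X (Suc (j + n)) \<omega> < thr k (Nm (Suc (j + n)) \<omega>) \<and>
      Nm (Suc (j + n)) \<omega> + of_bool (\<beta> \<le> X (Suc (j + n)) \<omega>) = Suc h" for \<omega> h
  proof -
    have "\<omega> \<in> weakened M j k (Suc n) h \<longleftrightarrow> Q \<omega> \<and>
        X (Suc (j + n)) \<omega> < thr (Np (Suc (j + n)) \<omega>) (Nm (Suc (j + n)) \<omega>) \<and>
        Nm (Suc (Suc (j + n))) \<omega> = Suc h"
      by (auto simp: weakened_def Q_def ball_Suc_iff)
    thus ?thesis using N by (auto simp: Nm_Suc)
  qed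
  have Q_space: "Q \<omega> \<Longrightarrow> \<omega> \<in> space M" for \<omega> by (simp add: Q_def)
  have below: "x < \<beta> \<Longrightarrow> x < thr k l" for x l using threshold_ge[of k l] by simp
  show "weakened M j k (Suc n) 0 =
      weakened M j k n 0 \<inter> {\<omega> \<in> space M. X (Suc (j + n)) \<omega> \<in> {..<\<beta>}}"
    unfolding set_eq_iff Int_iff w w' using N Q_space below by (auto simp: of_bool_def)
  show "weakened M j k (Suc n) (Suc h) =
      weakened M j k n (Suc h) \<inter> {\<omega> \<in> space M. X (Suc (j + n)) \<omega> \<in> {..<\<beta>}} \<union>
      weakened M j k n h \<inter> {\<omega> \<in> space M. X (Suc (j + n)) \<omega> \<in> {\<beta>..<thr k (Suc h)}}"
    unfolding set_eq_iff Int_iff Un_iff w w' using N Q_space below by (auto simp: of_bool_def)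
qed

lemma first_harmful_eq_iff:
  "j \<ge> 1 \<Longrightarrow> first_harmful \<beta> X \<omega> = enat j \<longleftrightarrow> \<beta> \<le> X j \<omega> \<and> (\<forall>i\<in>{1..<j}. X i \<omega> < \<beta>)"
  unfolding first_harmful_def Inf_enat_Collect_eq_iff by (auto simp: not_le)

lemma first_fatal_gt_iff:
  "enat m < first_fatal \<alpha> \<beta> \<gamma> b c X \<omega> \<longleftrightarrow> (\<forall>i\<in>{1..m}. X i \<omega> < thr (Np i \<omega>) (Nm i \<omega>))"
  unfolding first_fatal_def Inf_enat_Collect_gt_iff by (auto simp: not_le)

lemma first_fatal_eq_Suc_iff:
  "first_fatal \<alpha> \<beta> \<gamma> b c X \<omega> = enat (Suc m) \<longleftrightarrow>
    (\<forall>i\<in>{1..m}. X i \<omega> < thr (Np i \<omega>) (Nm i \<omega>)) \<and>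
    thr (Np (Suc m) \<omega>) (Nm (Suc m) \<omega>) \<le> X (Suc m) \<omega>"
  unfolding first_fatal_def Inf_enat_Collect_eq_iff
  by (auto simp: not_le less_Suc_eq_le Suc_le_eq)

lemma survival_event_eq_weakened:
  assumes "j \<ge> 1"
  shows "{\<omega> \<in> space M. enat (j + n) < first_fatal \<alpha> \<beta> \<gamma> b c X \<omega> \<and> Np (j + n) \<omega> = k \<and>
      Nm (Suc (j + n)) \<omega> = Suc h \<and> first_harmful \<beta> X \<omega> = enat j} = weakened M j k n h"
proof -
  have "Np (j + n) \<omega> = Np j \<omega>" if "\<forall>i\<in>{1..<j}. X i \<omega> < \<beta>" "\<beta> \<le> X j \<omega>"
    "\<forall>i\<in>{1..j + n}. X i \<omega> < thr (Np i \<omega>) (Nm i \<omega>)" for \<omega>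
    using N_after_first_harmful(2)[of j \<omega> "n - 1"] that assms by (cases n) auto
  thus ?thesis
    unfolding weakened_def first_fatal_gt_iff first_harmful_eq_iff[OF assms] set_eq_iff mem_Collect_eq
    by auto
qed

lemma fatal_event_eq_weakened:
  assumes "j \<ge> 1"
  shows "{\<omega> \<in> space M. first_fatal \<alpha> \<beta> \<gamma> b c X \<omega> = enat (Suc (j + n)) \<and> Np (Suc (j + n)) \<omega> = k \<and>
      Nm (Suc (j + n)) \<omega> = Suc h \<and> first_harmful \<beta> X \<omega> = enat j} =
    weakened M j k n h \<inter> {\<omega> \<in> space M. X (Suc (j + n)) \<omega> \<in> {thr k (Suc h)..}}"
proof -
  have "Np (Suc (j + n)) \<omega> = Np j \<omega>" if "\<forall>i\<in>{1..<j}. X i \<omega> < \<beta>" "\<beta> \<le> X j \<omega>"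
    "\<forall>i\<in>{1..j + n}. X i \<omega> < thr (Np i \<omega>) (Nm i \<omega>)" for \<omega>
    using N_after_first_harmful(2)[of j \<omega> n] that assms by auto
  thus ?thesis
    unfolding weakened_def first_fatal_eq_Suc_iff first_harmful_eq_iff[OF assms] set_eq_iff Int_iff
      mem_Collect_eq atLeast_iff
    by auto
qed

end

lemma (in prob_space) prob_less_eq_df:
  assumes "random_variable borel Y" "random_variable borel Z" "distr M borel Y = distr M borel Z"
  shows "\<P>(\<omega> in M. Y \<omega> \<in> {..<x}) = df M Z x"
proof -
  have "measure (distr M borel Y) {..<x} = measure (distr M borel Z) {..<x}"
    using assms(3) by simp
  thus ?thesis
    using assms(1,2) by (simp add: measure_distr df_def vimage_def Int_def conj_commute)
qed

lemma (in prob_space) prob_atLeast_eq_df_bar: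
  assumes "random_variable borel Y" "random_variable borel Z" "distr M borel Y = distr M borel Z"
  shows "\<P>(\<omega> in M. Y \<omega> \<in> {x..}) = df_bar M Z x"
proof -
  have "{\<omega> \<in> space M. Y \<omega> \<in> {x..}} = space M - {\<omega> \<in> space M. Y \<omega> \<in> {..<x}}" by auto
  moreover have "{\<omega> \<in> space M. Y \<omega> \<in> {..<x}} \<in> events" using assms(1) by measurable
  ultimately show ?thesis
    using prob_less_eq_df[OF assms, of x] by (simp add: prob_compl df_bar_def)
qed

lemma (in prob_space) prob_atLeastLessThan_eq_df_bar:
  assumes "random_variable borel Y" "random_variable borel Z" "distr M borel Y = distr M borel Z"
    and "x \<le> y"
  shows "\<P>(\<omega> in M. Y \<omega> \<in> {x..<y}) = df_bar M Z x - df_bar M Z y"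
proof -
  have "{\<omega> \<in> space M. Y \<omega> \<in> {x..<y}} =
      {\<omega> \<in> space M. Y \<omega> \<in> {..<y}} - {\<omega> \<in> space M. Y \<omega> \<in> {..<x}}" by auto
  moreover have "{\<omega> \<in> space M. Y \<omega> \<in> {..<z}} \<in> events" for z using assms(1) by measurable
  moreover have "{\<omega> \<in> space M. Y \<omega> \<in> {..<x}} \<subseteq> {\<omega> \<in> space M. Y \<omega> \<in> {..<y}}"
    using \<open>x \<le> y\<close> by auto
  ultimately show ?thesis
    using prob_less_eq_df[OF assms(1-3)] by (simp add: finite_measure_Diff df_bar_def)
qed


theorem mainTheorem1:
  fixes M :: "'a measure" and X :: "nat \<Rightarrow> 'a \<Rightarrow> real"
    and \<alpha> \<beta> \<gamma> :: real and b c :: "nat \<Rightarrow> real" and m j k l :: nat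
  assumes "prob_space M"
    and "prob_space.indep_vars M (\<lambda>_. borel) X {1..}"
    and "\<And>i. i \<ge> 1 \<Longrightarrow> distr M borel (X i) = distr M borel (X 1)"
    and "\<gamma> \<le> \<beta>" and "\<beta> \<le> \<alpha>"
    and "b 0 = 0" and "c 0 = 0" and "b 1 > 0" and "mono b" and "mono c"
    and "\<And>k l. threshold \<alpha> b c k l \<ge> \<beta>"
    and "j \<ge> 1" and "l \<ge> 1" and "k < j"
  shows "(m \<ge> j + l - 1 \<longrightarrow>
      \<P>(\<omega> in M. first_fatal \<alpha> \<beta> \<gamma> b c X \<omega> > enat m \<and> N_plus \<alpha> \<beta> \<gamma> b c X m \<omega> = k \<and>
          N_minus \<alpha> \<beta> \<gamma> b c X (m + 1) \<omega> = l \<and> first_harmful \<beta> X \<omega> = enat j)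
      = real ((j - 1) choose k) * df M (X 1) \<gamma> ^ (j - 1 - k)
        * (df_bar M (X 1) \<gamma> - df_bar M (X 1) \<beta>) ^ k
        * real ((m - j) choose (l - 1)) * df M (X 1) \<beta> ^ (m + 1 - j - l)
        * (\<Prod>h = 1..l. df_bar M (X 1) \<beta> - df_bar M (X 1) (threshold \<alpha> b c k (h - 1))))
    \<and> (m \<ge> j + l \<longrightarrow>
      \<P>(\<omega> in M. first_fatal \<alpha> \<beta> \<gamma> b c X \<omega> = enat m \<and> N_plus \<alpha> \<beta> \<gamma> b c X m \<omega> = k \<and>
          N_minus \<alpha> \<beta> \<gamma> b c X m \<omega> = l \<and> first_harmful \<beta> X \<omega> = enat j)
      = real ((j - 1) choose k) * df M (X 1) \<gamma> ^ (j - 1 - k)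
        * (df_bar M (X 1) \<gamma> - df_bar M (X 1) \<beta>) ^ k
        * real ((m - j - 1) choose (l - 1)) * df M (X 1) \<beta> ^ (m - j - l)
        * (\<Prod>h = 1..l. df_bar M (X 1) \<beta> - df_bar M (X 1) (threshold \<alpha> b c k (h - 1)))
        * df_bar M (X 1) (threshold \<alpha> b c k l))"
proof -
  interpret prob_space M by fact
  interpret shock_thresholds \<alpha> \<beta> \<gamma> b c X by unfold_locales fact
  note ind = assms(2)
  have rv: "random_variable borel (X i)" if "i \<ge> 1" for i
    using ind that by (auto simp: indep_vars_def)
  define F where "F = df M (X 1)"
  define G where "G = df_bar M (X 1)"
  obtain j' where j: "j = Suc j'" using \<open>j \<ge> 1\<close> by (cases j) auto
  obtain l' where l: "l = Suc l'" using \<open>l \<ge> 1\<close> by (cases l) auto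
  have lt: "\<P>(\<omega> in M. X i \<omega> \<in> {..<x}) = F x" if "i \<ge> 1" for i x
    unfolding F_def using that by (intro prob_less_eq_df rv assms(3)) auto
  have ge: "\<P>(\<omega> in M. X i \<omega> \<in> {x..}) = G x" if "i \<ge> 1" for i x
    unfolding G_def using that by (intro prob_atLeast_eq_df_bar rv assms(3)) auto
  have between: "\<P>(\<omega> in M. X i \<omega> \<in> {x..<y}) = G x - G y" if "i \<ge> 1" "x \<le> y" for i x y
    unfolding G_def using that by (intro prob_atLeastLessThan_eq_df_bar rv assms(3)) auto

  have H: "harmless M n h \<in> history M X (0 + n)"
    "prob (harmless M n h) =
      prob (space M) * real (n choose h) * F \<gamma> ^ (n - h) * (\<Prod>i<h. G \<gamma> - G \<beta>)" for n h
    by (rule counter_prob[where s = 0 and A = "harmless M" and U = "{..<\<gamma>}" and V = "\<lambda>_. {\<gamma>..<\<beta>}",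
          OF ind space_in_history harmless_0];
        simp add: harmless_Suc[OF \<open>\<gamma> \<le> \<beta>\<close>] lt between[OF _ \<open>\<gamma> \<le> \<beta>\<close>] lessThan_Int_atLeastLessThan
          del: lessThan_iff atLeastLessThan_iff)+
  let ?p = "real ((j - 1) choose k) * F \<gamma> ^ (j - 1 - k) * (G \<gamma> - G \<beta>) ^ k"
  have W0: "weakened M j k 0 0 \<in> history M X j"
    unfolding j weakened_0 using history_extend[OF H(1)[of j' k]]
    by (simp del: atLeastLessThan_iff)
  have pW0: "prob (weakened M j k 0 0) = ?p * (G \<beta> - G (thr k 0))"
    unfolding j weakened_0 using prob_history_Int[OF ind H(1)[of j' k], of "{\<beta>..<thr k 0}"]
    by (simp add: H(2) prob_space between[OF _ threshold_ge] del: atLeastLessThan_iff)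
  have W: "weakened M j k n h \<in> history M X (j + n)"
    "prob (weakened M j k n h) = prob (weakened M j k 0 0) * real (n choose h) * F \<beta> ^ (n - h)
      * (\<Prod>i<h. G \<beta> - G (thr k (Suc i)))" for n h
    by (rule counter_prob[where s = j and A = "weakened M j k" and U = "{..<\<beta>}"
            and V = "\<lambda>h. {\<beta>..<thr k (Suc h)}",
          OF ind W0 refl weakened_0(2)[of M j' k, folded j]];
        simp add: weakened_Suc[OF \<open>j \<ge> 1\<close>] lt between[OF _ threshold_ge] lessThan_Int_atLeastLessThan
          del: lessThan_iff atLeastLessThan_iff)+
  have prod: "(\<Prod>h = 1..l. G \<beta> - G (thr k (h - 1))) =
      (G \<beta> - G (thr k 0)) * (\<Prod>i<l'. G \<beta> - G (thr k (Suc i)))"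
  proof -
    have "(\<Prod>h = 1..l. G \<beta> - G (thr k (h - 1))) = (\<Prod>h<Suc l'. G \<beta> - G (thr k h))"
      unfolding l by (rule prod.reindex_bij_witness[of _ Suc "\<lambda>h. h - 1"]) auto
    thus ?thesis by (simp only: prod.lessThan_Suc_shift)
  qed
  have pW: "prob (weakened M j k n l') = ?p * real (n choose (l - 1)) * F \<beta> ^ (n + 1 - l)
      * (\<Prod>h = 1..l. G \<beta> - G (thr k (h - 1)))" for n
    unfolding prod W(2)[of n l'] pW0 by (simp add: l)

  have "\<P>(\<omega> in M. first_fatal \<alpha> \<beta> \<gamma> b c X \<omega> > enat m \<and> Np m \<omega> = k \<and>
          Nm (m + 1) \<omega> = l \<and> first_harmful \<beta> X \<omega> = enat j)
      = ?p * real ((m - j) choose (l - 1)) * F \<beta> ^ (m + 1 - j - l)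
        * (\<Prod>h = 1..l. G \<beta> - G (thr k (h - 1)))" if "m \<ge> j + l - 1"
  proof -
    have "j \<le> m" using that \<open>l \<ge> 1\<close> by simp
    then obtain n where m: "m = j + n" using le_Suc_ex by blast
    show ?thesis
      using survival_event_eq_weakened[OF \<open>j \<ge> 1\<close>, of M n k l'] pW[of n] by (simp add: m l)
  qed
  moreover have "\<P>(\<omega> in M. first_fatal \<alpha> \<beta> \<gamma> b c X \<omega> = enat m \<and> Np m \<omega> = k \<and>
          Nm m \<omega> = l \<and> first_harmful \<beta> X \<omega> = enat j)
      = ?p * real ((m - j - 1) choose (l - 1)) * F \<beta> ^ (m - j - l)
        * (\<Prod>h = 1..l. G \<beta> - G (thr k (h - 1))) * G (thr k l)" if "m \<ge> j + l"
  proof -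
    have "Suc j \<le> m" using that \<open>l \<ge> 1\<close> by simp
    then obtain n where m: "m = Suc (j + n)" by (auto dest: le_Suc_ex)
    have "prob (weakened M j k n l' \<inter> {\<omega> \<in> space M. X (Suc (j + n)) \<omega> \<in> {thr k l..}})
        = prob (weakened M j k n l') * G (thr k l)"
      using prob_history_Int[OF ind W(1), of "{thr k l..}"] by (simp add: ge del: atLeast_iff)
    thus ?thesis
      using fatal_event_eq_weakened[OF \<open>j \<ge> 1\<close>, of M n k l'] pW[of n] by (simp add: m l)
  qed
  ultimately show ?thesis unfolding F_def G_def by blast
qed

end
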